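(* Let $U,V$ be random variables on a common probability space supported within $[-1,1]$, with binary expansions $U=\sum_{d=1}^\infty A_d/2^d$ and $V=\sum_{d=1}^\infty B_d/2^d$, where $A_d,B_d\in\{-1,1\}$. For $D\ge1$ let $\mathcal{F}_D=\sigma(A_1,\dots,A_D)$. Then the following double limit holds: $$\mathbf{E}[V\mid U]\overset{a.s.}{=}\lim_{(D_1,D_2)\to\infty}\mathbf{E}\left[\sum_{d=1}^{D_2}\frac{B_d}{2^d}\,\Bigg|\,\mathcal{F}_{D_1}\right].$$
   Context: The limit is the joint (double) limit as $D_1$ and $D_2$ both tend to infinity, with no constraint on their relative rates; here $D_1$ is the binary expansion depth of $U$ and $D_2$ that of $V$. Uniqueness of the binary expansion $u=\sum_{d\ge1}a_d2^{-d}$, $a_d\in\{-1,1\}$, of $u\in[-1,1]$ is ensured by the convention that each number in $(-1,1]$ having two such expansions is given the one ending in repeating ones ($a_d=1$ for all large $d$); thus each bit is a deterministic function of the number. *)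

theory Defs
  imports "HOL-Probability.Probability"
begin

text \<open>
  Sequences are indexed by all of \<^typ>\<open>nat\<close>, whereas expansions start at index 1; fixing the
  value at index 0 makes an expansion unique as a function.
\<close>

definition binary_expansion :: "real \<Rightarrow> (nat \<Rightarrow> real) \<Rightarrow> bool" where
  "binary_expansion u a \<longleftrightarrow>
     a 0 = 0 \<and> (\<forall>d\<ge>1. a d \<in> {-1, 1}) \<and> (\<lambda>d. a (Suc d) / 2 ^ Suc d) sums u"

text \<open>
  A number with two expansions is given the one ending in repeating ones.  Outside \<open>[-1, 1]\<close>
  there is no expansion and the bits are unspecified constants.
\<close>

definition canonical_expansion :: "real \<Rightarrow> (nat \<Rightarrow> real) \<Rightarrow> bool" where
  "canonical_expansion u a \<longleftrightarrow>
     binary_expansion u a \<and>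
     ((\<exists>b. binary_expansion u b \<and> b \<noteq> a) \<longrightarrow> (\<exists>N. \<forall>d\<ge>N. a d = 1))"

definition binary_bit :: "real \<Rightarrow> nat \<Rightarrow> real" where
  "binary_bit u = (THE a. canonical_expansion u a)"

definition bit_algebra :: "'a measure \<Rightarrow> (nat \<Rightarrow> 'a \<Rightarrow> real) \<Rightarrow> nat \<Rightarrow> 'a measure" where
  "bit_algebra M A D =
     sigma (space M) (\<Union>d\<in>{1..D}. {A d -` S \<inter> space M | S. S \<in> sets borel})"

text \<open>Every number in \<open>[-1, 1]\<close> has exactly one canonical expansion.\<close>

definition pm_stream :: "real \<Rightarrow> (nat \<Rightarrow> real) \<Rightarrow> bool" where
  "pm_stream u s \<longleftrightarrow> (\<forall>d. s d \<in> {-1, 1}) \<and> (\<lambda>d. s d / 2 ^ Suc d) sums u"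

lemma pm_stream_shift:
  assumes "pm_stream u s"
  shows "pm_stream (2 * u - s 0) (\<lambda>d. s (Suc d))"
proof -
  have "(\<lambda>d. s d / 2 ^ Suc d) sums u"
    using assms by (simp add: pm_stream_def)
  then have "(\<lambda>d. s (Suc d) / 2 ^ Suc (Suc d)) sums (u - s 0 / 2)"
    by (subst sums_Suc_iff) simp
  from sums_mult[OF this, of 2] show ?thesis
    using assms by (simp add: pm_stream_def algebra_simps)
qed

lemma pm_stream_uminus: "pm_stream u s \<Longrightarrow> pm_stream (- u) (\<lambda>d. - s d)"
  unfolding pm_stream_def using sums_minus[of "\<lambda>d. s d / 2 ^ Suc d" u] by auto

lemma pm_stream_le_1:
  assumes "pm_stream u s"
  shows "u \<le> 1"
proof (rule sums_le)
  show "(\<lambda>d. s d / 2 ^ Suc d) sums u"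
    using assms by (simp add: pm_stream_def)
  show "(\<lambda>d. (1 / 2) ^ Suc d) sums (1 :: real)"
    by (rule power_half_series)
  show "s d / 2 ^ Suc d \<le> (1 / 2) ^ Suc d" for d
  proof -
    have "s d \<le> 1"
      using assms by (auto simp: pm_stream_def dest: spec[of _ d])
    then show ?thesis
      by (simp add: field_simps)
  qed
qed

lemma pm_stream_ge: "pm_stream u s \<Longrightarrow> -1 \<le> u"
  using pm_stream_le_1[OF pm_stream_uminus] by fastforce

lemma pm_stream_1: "pm_stream 1 s \<Longrightarrow> s d = 1"
proof (induction d arbitrary: s)
  case (0 s)
  then show ?case
    using pm_stream_le_1[OF pm_stream_shift[OF 0]] by (auto simp: pm_stream_def dest: spec[of _ 0])
next
  case (Suc d s)
  then have "s 0 = 1"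
    using pm_stream_le_1[OF pm_stream_shift[OF Suc.prems]]
    by (auto simp: pm_stream_def dest: spec[of _ 0])
  then show ?case
    using Suc.IH[of "\<lambda>d. s (Suc d)"] pm_stream_shift[OF Suc.prems] by simp
qed

lemma pm_stream_m1: "pm_stream (-1) s \<Longrightarrow> s d = -1"
  using pm_stream_uminus[of "-1" s] pm_stream_1[of "\<lambda>d. - s d" d] by simp

lemma pm_stream_differ:
  assumes "pm_stream u s" "pm_stream u t" "s n \<noteq> t n"
  shows "(\<exists>N. \<forall>d\<ge>N. s d = 1 \<and> t d = -1) \<or> (\<exists>N. \<forall>d\<ge>N. s d = -1 \<and> t d = 1)"
  using assms
proof (induction n arbitrary: u s t rule: less_induct)
  case (less n u s t)
  have tails: "\<exists>N. \<forall>d\<ge>N. x d = -1 \<and> y d = 1"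
    if x: "pm_stream u x" "x 0 = 1" and y: "pm_stream u y" "y 0 = -1" for x y
  proof -
    have "u = 0"
      using pm_stream_ge[OF pm_stream_shift[OF x(1)]] pm_stream_le_1[OF pm_stream_shift[OF y(1)]]
        x(2) y(2) by simp
    then have "pm_stream (-1) (\<lambda>d. x (Suc d))" "pm_stream 1 (\<lambda>d. y (Suc d))"
      using pm_stream_shift[OF x(1)] pm_stream_shift[OF y(1)] x(2) y(2) by simp_all
    then have "x (Suc d) = -1 \<and> y (Suc d) = 1" for d
      using pm_stream_m1[of "\<lambda>d. x (Suc d)" d] pm_stream_1[of "\<lambda>d. y (Suc d)" d] by simp
    then have "\<forall>d\<ge>1. x d = -1 \<and> y d = 1"
      by (metis One_nat_def Suc_le_D)
    then show ?thesis by blast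
  qed
  have digits: "s 0 \<in> {-1, 1}" "t 0 \<in> {-1, 1}"
    using less.prems by (auto simp: pm_stream_def)
  show ?case
  proof (cases "s 0 = t 0")
    case True
    then obtain m where m: "n = Suc m"
      using less.prems(3) by (cases n) auto
    have "(\<exists>N. \<forall>d\<ge>N. s (Suc d) = 1 \<and> t (Suc d) = -1) \<or>
          (\<exists>N. \<forall>d\<ge>N. s (Suc d) = -1 \<and> t (Suc d) = 1)"
      using less.IH[of m "2 * u - s 0" "\<lambda>d. s (Suc d)" "\<lambda>d. t (Suc d)"]
        pm_stream_shift[OF less.prems(1)] pm_stream_shift[OF less.prems(2)] less.prems(3) True m
      by simp
    then show ?thesis
      by (metis Suc_le_D Suc_le_mono)
  next
    case False
    then consider "s 0 = 1" "t 0 = -1" | "s 0 = -1" "t 0 = 1"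
      using digits by auto
    then show ?thesis
      using tails[of s t] tails[of t s] less.prems by cases blast+
  qed
qed

fun greedy_rest :: "real \<Rightarrow> nat \<Rightarrow> real" where
  "greedy_rest u 0 = u"
| "greedy_rest u (Suc n) =
     2 * greedy_rest u n - (if greedy_rest u n > 0 then 1 else -1)"

definition greedy_stream :: "real \<Rightarrow> nat \<Rightarrow> real" where
  "greedy_stream u n = (if greedy_rest u n > 0 then 1 else -1)"

lemma greedy_rest_bound: "\<bar>u\<bar> \<le> 1 \<Longrightarrow> \<bar>greedy_rest u n\<bar> \<le> 1"
  by (induction n) (auto simp: abs_le_iff split: if_splits)

lemma greedy_partial_sum:
  "(\<Sum>d<n. greedy_stream u d / 2 ^ Suc d) = u - greedy_rest u n / 2 ^ n"
  by (induction n) (auto simp: greedy_stream_def field_simps)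

lemma pm_stream_greedy:
  assumes "\<bar>u\<bar> \<le> 1"
  shows "pm_stream u (greedy_stream u)"
proof -
  have "(\<lambda>n. (1 / 2 :: real) ^ n) \<longlonglongrightarrow> 0"
    by (rule LIMSEQ_realpow_zero) auto
  then have "(\<lambda>n. greedy_rest u n / 2 ^ n) \<longlonglongrightarrow> 0"
    by (rule Lim_null_comparison[rotated])
      (auto intro!: always_eventually simp: power_divide divide_right_mono greedy_rest_bound[OF assms])
  then have "(\<lambda>n. u - greedy_rest u n / 2 ^ n) \<longlonglongrightarrow> u - 0"
    by (intro tendsto_intros)
  then show ?thesis
    unfolding pm_stream_def sums_def greedy_partial_sum by (auto simp: greedy_stream_def)
qed

lemma greedy_no_minus_tail:
  assumes tail: "\<forall>d\<ge>N. greedy_stream u d = -1" and "\<bar>u\<bar> \<le> 1"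
  shows "greedy_stream u d = -1"
proof -
  have shift: "pm_stream (greedy_rest u n) (\<lambda>d. greedy_stream u (d + n))" for n
  proof (induction n)
    case 0
    show ?case using pm_stream_greedy[OF assms(2)] by simp
  next
    case (Suc n)
    show ?case using pm_stream_shift[OF Suc] by (simp add: greedy_stream_def)
  qed
  have "pm_stream (-1) (\<lambda>_. -1)"
    using pm_stream_uminus[of 1 "\<lambda>_. 1"] power_half_series
    by (simp add: pm_stream_def power_divide)
  then have "greedy_rest u N = -1"
    using shift[of N] tail sums_unique2 by (fastforce simp: pm_stream_def)
  moreover have "greedy_rest u n = -1 \<Longrightarrow> u = -1" for n
    by (induction n) (auto split: if_splits)
  ultimately have "u = -1" by blast
  then show ?thesis
    using pm_stream_m1 pm_stream_greedy[OF assms(2)] by blast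
qed

lemma binary_expansion_imp_pm_stream:
  "binary_expansion u a \<Longrightarrow> pm_stream u (\<lambda>d. a (Suc d))"
  by (auto simp: binary_expansion_def pm_stream_def)

lemma binary_expansion_differ:
  assumes "binary_expansion u a" "binary_expansion u b" "a \<noteq> b"
  shows "(\<exists>N. \<forall>d\<ge>N. a d = 1 \<and> b d = -1) \<or> (\<exists>N. \<forall>d\<ge>N. a d = -1 \<and> b d = 1)"
proof -
  obtain n where "a n \<noteq> b n"
    using assms(3) by auto
  moreover from this obtain m where "n = Suc m"
    using assms(1,2) by (cases n) (auto simp: binary_expansion_def)
  ultimately have "(\<exists>N. \<forall>d\<ge>N. a (Suc d) = 1 \<and> b (Suc d) = -1) \<or>
                   (\<exists>N. \<forall>d\<ge>N. a (Suc d) = -1 \<and> b (Suc d) = 1)"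
    using pm_stream_differ[OF assms(1,2)[THEN binary_expansion_imp_pm_stream], of m] by simp
  then show ?thesis
    by (metis Suc_le_D Suc_le_mono)
qed

lemma ex1_canonical_expansion:
  assumes "u \<in> {-1..1}"
  shows "\<exists>!a. canonical_expansion u a"
proof (rule ex_ex1I)
  have u: "\<bar>u\<bar> \<le> 1" using assms by auto
  define a where "a = case_nat 0 (greedy_stream u)"
  have a: "binary_expansion u a"
    using pm_stream_greedy[OF u]
    by (auto simp: binary_expansion_def pm_stream_def a_def split: nat.splits)
  have "\<exists>N. \<forall>d\<ge>N. a d = 1" if b: "binary_expansion u b" "b \<noteq> a" for b
  proof (rule ccontr)
    assume "\<not> ?thesis"
    then obtain N where N: "\<forall>d\<ge>N. a d = -1 \<and> b d = 1"
      using binary_expansion_differ[OF a b(1)] b(2) by metis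
    then have "a (Suc d) = -1" if "d \<ge> N" for d
      using that by simp
    then have "\<forall>d\<ge>N. greedy_stream u d = -1"
      by (simp add: a_def)
    then have all: "greedy_stream u d = -1" for d
      using greedy_no_minus_tail[OF _ u] by blast
    have "pm_stream (-1) (\<lambda>_. -1)"
      using pm_stream_uminus[of 1 "\<lambda>_. 1"] power_half_series
      by (simp add: pm_stream_def power_divide)
    then have "u = -1"
      using pm_stream_greedy[OF u] all sums_unique2 by (fastforce simp: pm_stream_def)
    then have "b (Suc N) = -1"
      using pm_stream_m1 binary_expansion_imp_pm_stream[OF b(1)] by blast
    moreover have "b (Suc N) = 1"
      using N by simp
    ultimately show False by simp
  qed
  with a show "\<exists>a. canonical_expansion u a"
    by (auto simp: canonical_expansion_def)
next
  fix a b
  assume ab: "canonical_expansion u a" "canonical_expansion u b"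
  show "a = b"
  proof (rule ccontr)
    assume neq: "a \<noteq> b"
    then obtain N N' where N: "\<forall>d\<ge>N. a d = 1" "\<forall>d\<ge>N'. b d = 1"
      using ab unfolding canonical_expansion_def by metis
    obtain K where K: "\<forall>d\<ge>K. a d \<noteq> b d"
      using binary_expansion_differ[of u a b] ab neq unfolding canonical_expansion_def
      by (metis one_neq_neg_one)
    show False
      using N(1)[rule_format, of "K + N + N'"] N(2)[rule_format, of "K + N + N'"]
        K[rule_format, of "K + N + N'"] by simp
  qed
qed

lemma canonical_binary_bit: "u \<in> {-1..1} \<Longrightarrow> canonical_expansion u (binary_bit u)"
  unfolding binary_bit_def by (rule theI'[OF ex1_canonical_expansion])

end

theory Submission
  imports Defs
begin

text \<open>
  Truncating \<open>V\<close> after \<open>D\<^sub>2\<close> bits changes it by at most \<open>2\<^sup>-\<^sup>D\<^sup>2\<close>, hence changes every conditional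
  expectation by at most that much, uniformly in \<open>D\<^sub>1\<close>; so the double limit reduces to
  \<open>E[V | F\<^sub>D] \<longlonglongrightarrow> E[V | U]\<close>.  This is Levy's upward theorem, because \<open>U\<close> is almost surely the sum of
  its expansion and so the bits generate \<open>\<sigma>(U)\<close> up to null sets.  For Levy's theorem, the
  integrable functions \<open>f\<close> with \<open>E[f | F\<^sub>n] \<longlonglongrightarrow> f\<close> almost everywhere form a vector space containing
  every function measurable at a finite stage; by the maximal inequality it is closed under
  \<open>L\<^sup>1\<close>-limits, so it contains all integrable functions measurable in the limit.
\<close>

section \<open>Conditional expectations and Levy's upward theorem\<close>

locale finite_filtration = finite_measure M for M :: "'a measure" +
  fixes F :: "nat \<Rightarrow> 'a measure"
  assumes subalgebra_F: "subalgebra M (F n)"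
    and sets_F_Suc: "sets (F n) \<subseteq> sets (F (Suc n))"
begin

sublocale F: finite_measure_subalgebra M "F n" for n
  by unfold_locales (rule subalgebra_F)

definition F_inf :: "'a measure" where
  "F_inf = sigma (space M) (\<Union>n. sets (F n))"

lemma space_F [simp]: "space (F n) = space M"
  using subalgebra_F by (simp add: subalgebra_def)

lemma sets_F_subset: "sets (F n) \<subseteq> sets M"
  using subalgebra_F by (simp add: subalgebra_def)

lemma sets_F_mono: "m \<le> n \<Longrightarrow> sets (F m) \<subseteq> sets (F n)"
  by (rule lift_Suc_mono_le[of "\<lambda>n. sets (F n)", OF sets_F_Suc])

lemma measurable_F_mono:
  assumes "m \<le> n" "f \<in> measurable (F m) N"
  shows "f \<in> measurable (F n) N"
  using assms sets_F_mono[OF assms(1)] by (auto simp: measurable_def)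

lemma UN_sets_F_subset: "(\<Union>n. sets (F n)) \<subseteq> Pow (space M)"
  using sets_F_subset sets.sets_into_space by blast

lemma space_F_inf [simp]: "space F_inf = space M"
  using UN_sets_F_subset by (simp add: F_inf_def space_measure_of)

lemma sets_F_inf: "sets F_inf = sigma_sets (space M) (\<Union>n. sets (F n))"
  using UN_sets_F_subset by (simp add: F_inf_def sets_measure_of)

lemma subalgebra_F_inf: "subalgebra M F_inf"
  unfolding subalgebra_def sets_F_inf
  using sets_F_subset by (auto intro!: sets.sigma_sets_subset)

sublocale F_inf: finite_measure_subalgebra M F_inf
  by unfold_locales (rule subalgebra_F_inf)

lemma subalgebra_F_inf_F: "subalgebra F_inf (F n)"
  unfolding subalgebra_def sets_F_inf by auto

text \<open>Doob's weak-type inequality: split the event according to the first index at which the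
  conditional expectation exceeds \<open>c\<close>.\<close>

lemma maximal_inequality:
  assumes f: "integrable M f" "\<And>x. 0 \<le> f x" and c: "0 < c"
  shows "measure M {x \<in> space M. \<exists>n. c < real_cond_exp M (F n) f x} \<le> (\<integral>x. f x \<partial>M) / c"
proof -
  define A where "A n = {x \<in> space M. c < real_cond_exp M (F n) f x \<and>
    (\<forall>m<n. real_cond_exp M (F m) f x \<le> c)}" for n
  \<comment> \<open>Membership in \<open>F n\<close>, and not only in \<open>sets M\<close>, is what
    later lets \<open>f\<close> replace its conditional expectation given \<open>F n\<close> under
    the integral over \<open>A n\<close>.\<close>
  have A_F: "A n \<in> sets (F n)" for n
  proof -
    have meas: "real_cond_exp M (F m) f \<in> borel_measurable (F n)" if "m \<le> n" for m
      using that by (intro measurable_F_mono[of m n]) auto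
    have "{x \<in> space (F n). c < real_cond_exp M (F m) f x} \<in> sets (F n)" if "m \<le> n" for m
      by (rule borel_measurable_less[OF borel_measurable_const meas[OF that]])
    then have "{x \<in> space (F n). c < real_cond_exp M (F n) f x}
        - (\<Union>m\<in>{..<n}. {x \<in> space (F n). c < real_cond_exp M (F m) f x}) \<in> sets (F n)"
      by (intro sets.Diff sets.finite_UN) auto
    also have "{x \<in> space (F n). c < real_cond_exp M (F n) f x}
        - (\<Union>m\<in>{..<n}. {x \<in> space (F n). c < real_cond_exp M (F m) f x}) = A n"
      by (auto simp: A_def not_less)
    finally show ?thesis .
  qed
  have A_M [measurable]: "A n \<in> sets M" for n
    using A_F sets_F_subset by blast
  have disj: "disjoint_family A"
    unfolding disjoint_family_on_def
  proof (intro ballI impI)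
    fix m n :: nat assume "m \<noteq> n"
    then show "A m \<inter> A n = {}"
      by (cases m n rule: linorder_cases) (force simp: A_def)+
  qed
  have "{x \<in> space M. \<exists>n. c < real_cond_exp M (F n) f x} = (\<Union>n. A n)"
  proof (intro equalityI subsetI)
    fix x assume x: "x \<in> {x \<in> space M. \<exists>n. c < real_cond_exp M (F n) f x}"
    define n where "n = (LEAST n. c < real_cond_exp M (F n) f x)"
    have "c < real_cond_exp M (F n) f x"
      unfolding n_def by (rule LeastI_ex) (use x in auto)
    moreover have "real_cond_exp M (F m) f x \<le> c" if "m < n" for m
      using not_less_Least[of m "\<lambda>n. c < real_cond_exp M (F n) f x"] that
      by (simp add: n_def not_less)
    ultimately show "x \<in> (\<Union>n. A n)"
      using x by (auto simp: A_def)
  qed (auto simp: A_def)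
  moreover have "(\<lambda>n. measure M (A n)) sums measure M (\<Union>n. A n)"
    by (rule finite_measure_UNION) (use disj in auto)
  moreover have "(\<Sum>n<N. measure M (A n)) \<le> (\<integral>x. f x \<partial>M) / c" for N
  proof -
    have int: "integrable M (\<lambda>x. indicator (A n) x * f x)" for n
      using integrable_mult_indicator[OF A_M f(1)] by simp
    have "c * measure M (A n) \<le> (\<integral>x. indicator (A n) x * f x \<partial>M)" for n
    proof -
      have int': "integrable M (\<lambda>x. indicator (A n) x * real_cond_exp M (F n) f x)"
        using integrable_mult_indicator[OF A_M F.real_cond_exp_int(1)[OF f(1), of n]] by simp
      have "c * measure M (A n) = (\<integral>x. c * indicator (A n) x \<partial>M)"
        by simp
      also have "\<dots> \<le> (\<integral>x. indicator (A n) x * real_cond_exp M (F n) f x \<partial>M)"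
      proof (rule integral_mono[OF _ int'])
        show "integrable M (\<lambda>x. c * indicator (A n) x)"
          by (intro integrable_mult_right) (simp add: emeasure_eq_measure)
      qed (auto simp: A_def split: split_indicator)
      also have "\<dots> = (\<integral>x. indicator (A n) x * f x \<partial>M)"
        by (rule F.real_cond_exp_intg(2)) (use int A_F f(1) in auto)
      finally show ?thesis .
    qed
    then have "(\<Sum>n<N. c * measure M (A n)) \<le> (\<Sum>n<N. \<integral>x. indicator (A n) x * f x \<partial>M)"
      by (intro sum_mono)
    also have "\<dots> = (\<integral>x. (\<Sum>n<N. indicator (A n) x * f x) \<partial>M)"
      using int by (intro Bochner_Integration.integral_sum[symmetric])
    also have "\<dots> \<le> (\<integral>x. f x \<partial>M)"
    proof (rule integral_mono)
      \<comment> \<open>The events are disjoint, so the indicators add up to at most 1, and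
        \<open>f\<close> is nonnegative.\<close>
      show "(\<Sum>n<N. indicator (A n) x * f x) \<le> f x" for x
      proof -
        have "indicator (\<Union>n\<in>{..<N}. A n) x = (\<Sum>n<N. indicator (A n) x :: real)"
          by (rule indicator_UN_disjoint)
            (use disj disjoint_family_on_mono[of "{..<N}" UNIV A] in auto)
        then have "(\<Sum>n<N. indicator (A n) x * f x) = indicator (\<Union>n\<in>{..<N}. A n) x * f x"
          by (simp only: sum_distrib_right)
        also have "\<dots> \<le> f x"
          using f(2)[of x] by (simp split: split_indicator)
        finally show ?thesis .
      qed
    qed (rule Bochner_Integration.integrable_sum[OF int], rule f(1))
    finally show ?thesis
      using c by (simp add: pos_le_divide_eq mult.commute flip: sum_distrib_left)
  qed
  ultimately show ?thesis
    by (simp add: sums_def LIMSEQ_le_const2)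
qed

section \<open>Integrable functions recovered as limits of their own conditional
  expectations\<close>

definition cond_exp_converges :: "('a \<Rightarrow> real) \<Rightarrow> bool" where
  "cond_exp_converges f \<longleftrightarrow>
     integrable M f \<and> (AE x in M. (\<lambda>n. real_cond_exp M (F n) f x) \<longlonglongrightarrow> f x)"

text \<open>From stage \<open>n\<close> on, \<open>f\<close> is almost everywhere its own
  conditional expectation; once countably many null sets are discarded, the sequence is eventually
  constant.\<close>

lemma cond_exp_converges_F:
  assumes f: "integrable M f" "f \<in> borel_measurable (F n)"
  shows "cond_exp_converges f"
proof -
  have "AE x in M. \<forall>m\<ge>n. real_cond_exp M (F m) f x = f x"
    unfolding AE_all_countable
  proof
    fix m
    show "AE x in M. m \<ge> n \<longrightarrow> real_cond_exp M (F m) f x = f x"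
    proof (cases "m \<ge> n")
      case True
      then have "f \<in> borel_measurable (F m)"
        using f(2) measurable_F_mono by blast
      then have "AE x in M. real_cond_exp M (F m) f x = f x"
        using f(1) by blast
      then show ?thesis by eventually_elim simp
    qed simp
  qed
  then have "AE x in M. (\<lambda>n. real_cond_exp M (F n) f x) \<longlonglongrightarrow> f x"
  proof eventually_elim
    case (elim x)
    then show ?case
      by (intro tendsto_eventually) (auto simp: eventually_sequentially)
  qed
  with f show ?thesis by (simp add: cond_exp_converges_def)
qed

lemma cond_exp_converges_add:
  assumes "cond_exp_converges f" "cond_exp_converges g"
  shows "cond_exp_converges (\<lambda>x. f x + g x)"
proof -
  have "AE x in M. \<forall>n. real_cond_exp M (F n) (\<lambda>x. f x + g x) x
      = real_cond_exp M (F n) f x + real_cond_exp M (F n) g x"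
    unfolding AE_all_countable
    using assms by (intro allI F.real_cond_exp_add) (auto simp: cond_exp_converges_def)
  moreover have "AE x in M. (\<lambda>n. real_cond_exp M (F n) f x) \<longlonglongrightarrow> f x"
    "AE x in M. (\<lambda>n. real_cond_exp M (F n) g x) \<longlonglongrightarrow> g x"
    using assms by (auto simp: cond_exp_converges_def)
  ultimately have "AE x in M. (\<lambda>n. real_cond_exp M (F n) (\<lambda>x. f x + g x) x) \<longlonglongrightarrow> f x + g x"
    by eventually_elim (auto intro: tendsto_add)
  with assms show ?thesis by (auto simp: cond_exp_converges_def)
qed

lemma cond_exp_converges_cmult:
  assumes "cond_exp_converges f"
  shows "cond_exp_converges (\<lambda>x. c * f x)"
proof -
  have "AE x in M. \<forall>n. real_cond_exp M (F n) (\<lambda>x. c * f x) x = c * real_cond_exp M (F n) f x"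
    unfolding AE_all_countable
    using assms by (intro allI F.real_cond_exp_cmult) (auto simp: cond_exp_converges_def)
  moreover have "AE x in M. (\<lambda>n. real_cond_exp M (F n) f x) \<longlonglongrightarrow> f x"
    using assms by (auto simp: cond_exp_converges_def)
  ultimately have "AE x in M. (\<lambda>n. real_cond_exp M (F n) (\<lambda>x. c * f x) x) \<longlonglongrightarrow> c * f x"
    by eventually_elim (auto intro: tendsto_mult_left)
  with assms show ?thesis by (auto simp: cond_exp_converges_def)
qed

text \<open>Linearity and monotonicity are applied to both \<open>f - h\<close> and
  \<open>h - f\<close>. The bound involves one nonnegative function for all \<open>n\<close>, so the
  maximal inequality controls the error at all stages together.\<close>

lemma cond_exp_diff_le:
  assumes "integrable M f" "integrable M h"
  shows "AE x in M. \<bar>real_cond_exp M (F n) f x - real_cond_exp M (F n) h x\<bar>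
    \<le> real_cond_exp M (F n) (\<lambda>x. \<bar>f x - h x\<bar>) x"
proof -
  have "AE x in M. real_cond_exp M (F n) (\<lambda>x. f x - h x) x
      = real_cond_exp M (F n) f x - real_cond_exp M (F n) h x"
    "AE x in M. real_cond_exp M (F n) (\<lambda>x. h x - f x) x
      = real_cond_exp M (F n) h x - real_cond_exp M (F n) f x"
    using assms by (intro F.real_cond_exp_diff; simp)+
  moreover have "AE x in M. real_cond_exp M (F n) (\<lambda>x. f x - h x) x
      \<le> real_cond_exp M (F n) (\<lambda>x. \<bar>f x - h x\<bar>) x"
    "AE x in M. real_cond_exp M (F n) (\<lambda>x. h x - f x) x
      \<le> real_cond_exp M (F n) (\<lambda>x. \<bar>f x - h x\<bar>) x"
    using assms by (intro F.real_cond_exp_mono; simp)+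
  ultimately show ?thesis
    by eventually_elim linarith
qed

text \<open>Choose approximations with \<open>L\<^sup>1\<close>-error \<open>4\<^sup>-\<^sup>k\<close>; by the maximal inequality the events on which
  the error, or some conditional expectation of it, exceeds \<open>2\<^sup>-\<^sup>k\<close> are summable, so Borel--Cantelli
  applies.\<close>

lemma cond_exp_converges_L1_limit:
  assumes f: "integrable M f"
    and approx: "\<And>e. 0 < e \<Longrightarrow> \<exists>h. cond_exp_converges h \<and> (\<integral>x. \<bar>f x - h x\<bar> \<partial>M) < e"
  shows "cond_exp_converges f"
proof -
  have "\<exists>h. cond_exp_converges h \<and> (\<integral>x. \<bar>f x - h x\<bar> \<partial>M) < (1 / 4) ^ k" for k :: nat
    by (rule approx) simp
  then obtain h where h: "\<And>k. cond_exp_converges (h k)"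
    and h_close: "\<And>k :: nat. (\<integral>x. \<bar>f x - h k x\<bar> \<partial>M) < (1 / 4) ^ k"
    by metis
  have h_int: "integrable M (h k)" for k
    using h by (simp add: cond_exp_converges_def)
  note [measurable] = borel_measurable_integrable[OF f] borel_measurable_integrable[OF h_int]
  define d where "d k x = \<bar>f x - h k x\<bar>" for k x
  have d_int: "integrable M (d k)" for k
    unfolding d_def using f h_int by auto
  note [measurable] = borel_measurable_integrable[OF d_int]
  define B1 where "B1 k = {x \<in> space M. \<exists>n. (1 / 2) ^ k < real_cond_exp M (F n) (d k) x}" for k
  define B2 where "B2 k = {x \<in> space M. (1 / 2) ^ k \<le> d k x}" for k
  have [measurable]: "B1 k \<in> sets M" "B2 k \<in> sets M" for k
    unfolding B1_def B2_def by measurable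
  \<comment> \<open>An error below (1/4)^k divided by the threshold (1/2)^k leaves the summable
    bound (1/2)^k; the maximal inequality and Markov's inequality both end in this quotient.\<close>
  have le: "(\<integral>x. d k x \<partial>M) / (1 / 2) ^ k \<le> (1 / 2) ^ k" for k
  proof -
    have "(\<integral>x. d k x \<partial>M) \<le> (1 / 2) ^ k * (1 / 2) ^ k"
      using h_close[of k] by (simp add: d_def flip: power_mult_distrib)
    then show ?thesis by (simp add: field_simps)
  qed
  have B1: "measure M (B1 k) \<le> (1 / 2) ^ k" for k
    unfolding B1_def
    by (rule order_trans[OF maximal_inequality[OF d_int] le]) (auto simp: d_def)
  have B2: "measure M (B2 k) \<le> (1 / 2) ^ k" for k
    unfolding B2_def
    by (rule order_trans[OF integral_Markov_inequality_measure[OF d_int, of "space M"] le])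
      (auto simp: d_def)
  have summable: "summable (\<lambda>k. measure M (B1 k))" "summable (\<lambda>k. measure M (B2 k))"
    by (rule summable_comparison_test'[of "\<lambda>k. (1 / 2 :: real) ^ k" 0];
        use B1 B2 in simp)+
  have "AE x in M. eventually (\<lambda>k. x \<in> space M - B1 k) sequentially"
    "AE x in M. eventually (\<lambda>k. x \<in> space M - B2 k) sequentially"
    by (rule borel_cantelli_AE1; use summable in \<open>auto simp: emeasure_eq_measure\<close>)+
  moreover have "AE x in M. \<forall>k n. \<bar>real_cond_exp M (F n) f x - real_cond_exp M (F n) (h k) x\<bar>
      \<le> real_cond_exp M (F n) (d k) x"
    unfolding AE_all_countable d_def using cond_exp_diff_le[OF f h_int] by blast
  moreover have "AE x in M. \<forall>k. (\<lambda>n. real_cond_exp M (F n) (h k) x) \<longlonglongrightarrow> h k x"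
    unfolding AE_all_countable using h by (simp add: cond_exp_converges_def)
  ultimately have "AE x in M. (\<lambda>n. real_cond_exp M (F n) f x) \<longlonglongrightarrow> f x"
  proof eventually_elim
    case (elim x)
    show ?case
    proof (rule LIMSEQ_I)
      fix r :: real assume r: "0 < r"
      \<comment> \<open>The distance is split into three parts below \<open>r / 3\<close>. Fixing
        \<open>k\<close> first makes small the error at \<open>x\<close> and its conditional
        expectations at every stage; only then is \<open>N\<close> chosen, from the convergence for
        \<open>h k\<close>.\<close>
      have "eventually (\<lambda>k. (1 / 2 :: real) ^ k < r / 3) sequentially"
        by (rule order_tendstoD(2)[OF LIMSEQ_realpow_zero]) (use r in auto)
      with elim(1,2) have "eventually (\<lambda>k. (1 / 2) ^ k < r / 3 \<and> x \<in> space M - B1 k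
          \<and> x \<in> space M - B2 k) sequentially"
        by eventually_elim simp
      then obtain k where k: "(1 / 2) ^ k < r / 3" "x \<in> space M - B1 k" "x \<in> space M - B2 k"
        using eventually_happens by fastforce
      obtain N where N: "\<And>n. n \<ge> N \<Longrightarrow> \<bar>real_cond_exp M (F n) (h k) x - h k x\<bar> < r / 3"
        using LIMSEQ_D[OF elim(4)[rule_format], of "r / 3" k] r by auto
      have "\<bar>real_cond_exp M (F n) f x - f x\<bar> < r" if "n \<ge> N" for n
      proof -
        have "real_cond_exp M (F n) (d k) x \<le> (1 / 2) ^ k"
          using k(2) by (auto simp: B1_def not_less)
        moreover have "\<bar>f x - h k x\<bar> < (1 / 2) ^ k"
          using k(3) by (auto simp: B2_def d_def not_le)
        ultimately show ?thesis
          using N[OF that] elim(3)[rule_format, of n k] k(1) by linarith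
      qed
      then show "\<exists>N. \<forall>n\<ge>N. norm (real_cond_exp M (F n) f x - f x) < r"
        by auto
    qed
  qed
  with f show ?thesis by (simp add: cond_exp_converges_def)
qed

text \<open>Dominated convergence, with |f| + w as majorant of the error, turns the pointwise limit
  into an L1-limit.\<close>

lemma cond_exp_converges_pointwise_limit:
  assumes f: "integrable M f" and s: "\<And>k. cond_exp_converges (s k)"
    and lim: "\<And>x. x \<in> space M \<Longrightarrow> (\<lambda>k. s k x) \<longlonglongrightarrow> f x"
    and w: "integrable M w" "\<And>k x. x \<in> space M \<Longrightarrow> \<bar>s k x\<bar> \<le> w x"
  shows "cond_exp_converges f"
proof (rule cond_exp_converges_L1_limit[OF f])
  fix e :: real assume e: "0 < e"
  have s_int: "integrable M (s k)" for k
    using s by (simp add: cond_exp_converges_def)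
  have "(\<lambda>k. \<integral>x. \<bar>f x - s k x\<bar> \<partial>M) \<longlonglongrightarrow> (\<integral>x. 0 \<partial>M)"
  proof (rule integral_dominated_convergence[where w = "\<lambda>x. \<bar>f x\<bar> + w x"])
    show "AE x in M. (\<lambda>k. \<bar>f x - s k x\<bar>) \<longlonglongrightarrow> 0"
    proof (rule AE_I2)
      fix x assume "x \<in> space M"
      then have "(\<lambda>k. f x - s k x) \<longlonglongrightarrow> f x - f x"
        by (intro tendsto_intros lim)
      then show "(\<lambda>k. \<bar>f x - s k x\<bar>) \<longlonglongrightarrow> 0"
        by (simp add: tendsto_rabs_zero)
    qed
    show "AE x in M. norm \<bar>f x - s k x\<bar> \<le> \<bar>f x\<bar> + w x" for k
    proof (rule AE_I2)
      fix x assume "x \<in> space M"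
      then show "norm \<bar>f x - s k x\<bar> \<le> \<bar>f x\<bar> + w x"
        using w(2)[of x k] by simp
    qed
  qed (use f s_int w(1) in auto)
  then have "eventually (\<lambda>k. (\<integral>x. \<bar>f x - s k x\<bar> \<partial>M) < e) sequentially"
    using e by (intro order_tendstoD(2)) auto
  then show "\<exists>h. cond_exp_converges h \<and> (\<integral>x. \<bar>f x - h x\<bar> \<partial>M) < e"
    using s eventually_happens by fastforce
qed

text \<open>Dynkin's argument: two sets of finite stages lie in a common stage, so the union of the
  stages is an intersection-stable generator, and the sets with the property are closed under
  complements and countable disjoint unions.\<close>

lemma cond_exp_converges_indicator:
  assumes "A \<in> sets F_inf"
  shows "cond_exp_converges (indicator A)"
proof -
  have "Int_stable (\<Union>n. sets (F n))"
  proof (rule Int_stableI)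
    fix a b assume "a \<in> (\<Union>n. sets (F n))" "b \<in> (\<Union>n. sets (F n))"
    then obtain m n where "a \<in> sets (F m)" "b \<in> sets (F n)" by auto
    then have "a \<in> sets (F (max m n))" "b \<in> sets (F (max m n))"
      using sets_F_mono[of m "max m n"] sets_F_mono[of n "max m n"] by auto
    then show "a \<inter> b \<in> (\<Union>n. sets (F n))" by blast
  qed
  from this UN_sets_F_subset assms[unfolded sets_F_inf] show ?thesis
  proof (induction rule: sigma_sets_induct_disjoint)
    case (basic A)
    then obtain n where n: "A \<in> sets (F n)" by auto
    then have "A \<in> sets M" using sets_F_subset by blast
    then have "integrable M (indicator A :: 'a \<Rightarrow> real)"
      by (simp add: emeasure_eq_measure)
    with n show ?case
      by (intro cond_exp_converges_F[of _ n]) auto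
  next
    case empty
    show ?case
      by (intro cond_exp_converges_F[of _ 0]) auto
  next
    case (compl A)
    have A: "A \<in> sets M"
      using compl(1) subalgebra_F_inf by (auto simp: subalgebra_def sets_F_inf)
    have one: "cond_exp_converges (\<lambda>_. 1)"
      by (intro cond_exp_converges_F[of _ 0]) auto
    have "cond_exp_converges (\<lambda>x. 1 + (-1) * indicator A x)"
      by (intro cond_exp_converges_add one cond_exp_converges_cmult compl)
    \<comment> \<open>The constant sequence transfers the property to the indicator of the
      complement, which agrees with \<open>1 + (-1) * indicator A x\<close> only on
      \<open>space M\<close>.\<close>
    show ?case
    proof (rule cond_exp_converges_pointwise_limit
        [where s = "\<lambda>_ x. 1 + (-1) * indicator A x" and w = "\<lambda>_. 1"])
      show "integrable M (indicator (space M - A) :: 'a \<Rightarrow> real)"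
        using A by (simp add: emeasure_eq_measure)
    qed (use \<open>cond_exp_converges (\<lambda>x. 1 + (-1) * indicator A x)\<close> in
        \<open>auto split: split_indicator\<close>)
  next
    case (union A)
    have A: "A i \<in> sets M" for i
      using union(2) subalgebra_F_inf by (auto simp: subalgebra_def sets_F_inf)
    have partial: "cond_exp_converges (\<lambda>x. \<Sum>i<k. indicator (A i) x)" for k :: nat
    proof (induction k)
      case 0
      show ?case
        by (intro cond_exp_converges_F[of _ 0]) auto
    next
      case (Suc k)
      then show ?case
        using cond_exp_converges_add[OF Suc union(3)[of k]] by simp
    qed
    \<comment> \<open>By disjointness the partial sums are indicators of finite unions, hence
      bounded by 1.\<close>
    have eq: "(\<Sum>i<k. indicator (A i) x) = (indicator (\<Union>i\<in>{..<k}. A i) x :: real)" for k x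
      by (rule indicator_UN_disjoint[symmetric])
        (use union(1) disjoint_family_on_mono[of "{..<k}" UNIV A] in auto)
    show ?case
    proof (rule cond_exp_converges_pointwise_limit
        [where s = "\<lambda>k x. \<Sum>i<k. indicator (A i) x" and w = "\<lambda>_. 1"])
      show "integrable M (indicator (\<Union>i. A i) :: 'a \<Rightarrow> real)"
        using A by (simp add: emeasure_eq_measure)
      show "(\<lambda>k. \<Sum>i<k. indicator (A i) x) \<longlonglongrightarrow> (indicator (\<Union>i. A i) x :: real)" for x
        unfolding eq by (rule LIMSEQ_indicator_UN)
      show "\<bar>\<Sum>i<k. indicator (A i) x\<bar> \<le> (1 :: real)" for k x
        unfolding eq by (simp split: split_indicator)
    qed (use partial in auto)
  qed
qed

text \<open>The induction runs over the functions integrable for the restriction of \<open>M\<close>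
  to \<open>F_inf\<close>, so that every set and every approximating function it supplies is
  measurable in \<open>F_inf\<close>.\<close>

lemma cond_exp_converges_F_inf:
  assumes "integrable M f" "f \<in> borel_measurable F_inf"
  shows "cond_exp_converges f"
  using integrable_in_subalg[OF subalgebra_F_inf assms(2,1)]
proof (induction rule: integrable_induct)
  case (base A c)
  then have "A \<in> sets F_inf"
    by (simp add: sets_restr_to_subalg[OF subalgebra_F_inf])
  from cond_exp_converges_cmult[OF cond_exp_converges_indicator[OF this], of c]
  show ?case by (simp add: mult.commute)
next
  case (add f g)
  then show ?case by (intro cond_exp_converges_add)
next
  case (lim f s)
  have f: "integrable M f"
    using \<open>integrable (restr_to_subalg M F_inf) f\<close>
    by (rule integrable_from_subalg[OF subalgebra_F_inf])
  show ?case
  \<comment> \<open>The factor 2 is the one in \<open>integrable_induct\<close>, whose approximating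
    sequences are dominated by twice the norm of the limit.\<close>
  proof (rule cond_exp_converges_pointwise_limit[where s = s and w = "\<lambda>x. 2 * \<bar>f x\<bar>"])
    show "(\<lambda>k. s k x) \<longlonglongrightarrow> f x" if "x \<in> space M" for x
      using that by (intro lim.hyps(2)) (simp add: space_restr_to_subalg)
    show "\<bar>s k x\<bar> \<le> 2 * \<bar>f x\<bar>" if "x \<in> space M" for k x
      using that lim.hyps(3)[of x k] by (simp add: space_restr_to_subalg)
  qed (use f lim.IH in auto)
qed

text \<open>Conditioning \<open>f\<close> on \<open>F_inf\<close> first makes it measurable in the
  limit and, by the tower property, changes none of the conditional expectations given
  \<open>F n\<close>.\<close>

theorem levy_upward:
  assumes f: "integrable M f"
  shows "AE x in M. (\<lambda>n. real_cond_exp M (F n) f x) \<longlonglongrightarrow> real_cond_exp M F_inf f x"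
proof -
  have "cond_exp_converges (real_cond_exp M F_inf f)"
    by (intro cond_exp_converges_F_inf F_inf.real_cond_exp_int(1) f) simp
  then have "AE x in M. (\<lambda>n. real_cond_exp M (F n) (real_cond_exp M F_inf f) x)
      \<longlonglongrightarrow> real_cond_exp M F_inf f x"
    by (simp add: cond_exp_converges_def)
  moreover have "AE x in M. \<forall>n. real_cond_exp M (F n) (real_cond_exp M F_inf f) x
      = real_cond_exp M (F n) f x"
    unfolding AE_all_countable
    using f by (intro allI F.real_cond_exp_nested_subalg subalgebra_F_inf subalgebra_F_inf_F)
  ultimately show ?thesis by eventually_elim simp
qed

end

text \<open>Integrals over a set of \<open>G\<close> and over its counterpart in \<open>H\<close>
  agree, so the conditional expectation given \<open>H\<close> has the defining property of the one
  given \<open>G\<close>. This is needed because \<open>U\<close> is only almost surely the sum of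
  its bits, so its sigma-algebra may be larger than the one they generate.\<close>

lemma real_cond_exp_null_extension:
  assumes M: "finite_measure M" and G: "subalgebra M G" and H: "subalgebra G H"
    and null: "\<And>S. S \<in> sets G \<Longrightarrow> \<exists>T\<in>sets H. AE x in M. x \<in> S \<longleftrightarrow> x \<in> T"
    and f: "integrable M f"
  shows "AE x in M. real_cond_exp M G f x = real_cond_exp M H f x"
proof -
  have MH: "subalgebra M H"
    using G H by (auto simp: subalgebra_def)
  interpret finite_measure M by (rule M)
  interpret G: finite_measure_subalgebra M G by unfold_locales (rule G)
  interpret H: finite_measure_subalgebra M H by unfold_locales (rule MH)
  show ?thesis
  proof (rule G.real_cond_exp_charact)
    fix S assume S: "S \<in> sets G"
    with null obtain T where T: "T \<in> sets H" "AE x in M. x \<in> S \<longleftrightarrow> x \<in> T"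
      by blast
    have [measurable]: "S \<in> sets M" "T \<in> sets M"
      using S T(1) G MH by (auto simp: subalgebra_def)
    note [measurable] = borel_measurable_integrable[OF f]
    have AE: "AE x in M. x \<in> T \<longleftrightarrow> x \<in> S"
      using T(2) by eventually_elim simp
    have "(\<integral>x\<in>S. f x \<partial>M) = (\<integral>x\<in>T. f x \<partial>M)"
      by (rule set_integral_cong_set[OF _ _ AE]) (simp_all add: set_borel_measurable_def)
    also have "\<dots> = (\<integral>x\<in>T. real_cond_exp M H f x \<partial>M)"
      by (rule H.real_cond_exp_intA[OF f T(1)])
    also have "\<dots> = (\<integral>x\<in>S. real_cond_exp M H f x \<partial>M)"
      by (rule set_integral_cong_set[OF _ _ T(2)]) (simp_all add: set_borel_measurable_def)
    finally show "(\<integral>x\<in>S. f x \<partial>M) = (\<integral>x\<in>S. real_cond_exp M H f x \<partial>M)" .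
  next
    show "real_cond_exp M H f \<in> borel_measurable G"
      by (rule measurable_from_subalg[OF H]) simp
  qed (use f in auto)
qed

section \<open>Binary digits\<close>

text \<open>A remainder 0 gets the digit -1 and then only ones, as the convention demands. Any
  discrepancy would make the greedy digits end in -1 and hence be constantly -1, so
  \<open>u = -1\<close>, which has no expansion ending in ones. The recursion then yields
  measurability and the truncation error.\<close>

lemma binary_bit_eq_greedy:
  assumes "u \<in> {-1..1}"
  shows "binary_bit u = case_nat 0 (greedy_stream u)"
proof (rule ccontr)
  let ?g = "case_nat 0 (greedy_stream u)"
  assume neq: "binary_bit u \<noteq> ?g"
  have u: "\<bar>u\<bar> \<le> 1" using assms by auto
  have g: "binary_expansion u ?g"
    using pm_stream_greedy[OF u]
    by (auto simp: binary_expansion_def pm_stream_def split: nat.splits)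
  have b: "binary_expansion u (binary_bit u)"
    and "(\<exists>b. binary_expansion u b \<and> b \<noteq> binary_bit u) \<longrightarrow> (\<exists>N. \<forall>d\<ge>N. binary_bit u d = 1)"
    using canonical_binary_bit[OF assms] by (simp_all add: canonical_expansion_def)
  with g neq obtain N where N: "\<forall>d\<ge>N. binary_bit u d = 1" by metis
  obtain K where K: "\<forall>d\<ge>K. ?g d = -1"
    using binary_expansion_differ[OF b g neq]
  proof (elim disjE exE)
    fix K assume "\<forall>d\<ge>K. binary_bit u d = -1 \<and> ?g d = 1"
    then have "binary_bit u (max K N) = -1" by simp
    with N show ?thesis by simp
  qed blast
  have "\<forall>d\<ge>K. greedy_stream u d = -1"
  proof (intro allI impI)
    fix d assume "K \<le> d"
    then show "greedy_stream u d = -1"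
      using K[rule_format, of "Suc d"] by simp
  qed
  then have all: "greedy_stream u d = -1" for d
    using greedy_no_minus_tail[OF _ u] by blast
  have "pm_stream (-1) (\<lambda>_. -1)"
    using pm_stream_uminus[of 1 "\<lambda>_. 1"] power_half_series
    by (simp add: pm_stream_def power_divide)
  then have "u = -1"
    using pm_stream_greedy[OF u] all sums_unique2 by (fastforce simp: pm_stream_def)
  then have "binary_bit u (Suc N) = -1"
    using pm_stream_m1 binary_expansion_imp_pm_stream[OF b] by blast
  with N show False by simp
qed

section \<open>Measurability of the bits and the error of truncation\<close>

lemma borel_measurable_greedy_rest [measurable]:
  "(\<lambda>u. greedy_rest u n) \<in> borel_measurable borel"
  by (induction n) simp_all

lemma borel_measurable_binary_bit [measurable]:
  "(\<lambda>u. binary_bit u d) \<in> borel_measurable borel"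
proof -
  \<comment> \<open>Outside [-1, 1] the definite description is taken over the empty predicate; its
    value is unknown but the same for all such \<open>u\<close>, hence harmless for
    measurability.\<close>
  have none: "canonical_expansion u = (\<lambda>_. False)" if "u \<notin> {-1..1}" for u
    using that pm_stream_ge pm_stream_le_1 binary_expansion_imp_pm_stream
    by (fastforce simp: canonical_expansion_def fun_eq_iff)
  have outside: "binary_bit u d = (THE a. False) d" if "u \<notin> {-1..1}" for u
    unfolding binary_bit_def none[OF that] ..
  have "binary_bit u d = (if u \<in> {-1..1}
      then case d of 0 \<Rightarrow> 0 | Suc n \<Rightarrow> (if 0 < greedy_rest u n then 1 else -1)
      else (THE a. False) d)" for u
  proof (cases "u \<in> {-1..1}")
    case True
    then show ?thesis
      by (simp add: binary_bit_eq_greedy greedy_stream_def split: nat.split)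
  next
    case False
    then show ?thesis
      using outside[OF False] by (simp only: if_False)
  qed
  then show ?thesis
    by (cases d) simp_all
qed

text \<open>The error is the greedy remainder, which stays in [-1, 1], scaled by
  \<open>2 ^ D\<close>.\<close>

lemma binary_bit_partial_sum_error:
  assumes "u \<in> {-1..1}"
  shows "\<bar>(\<Sum>d=1..D. binary_bit u d / 2 ^ d) - u\<bar> \<le> (1 / 2) ^ D"
proof -
  have "(\<Sum>d=1..D. binary_bit u d / 2 ^ d) = u - greedy_rest u D / 2 ^ D"
    unfolding greedy_partial_sum[symmetric]
    by (simp add: sum.atLeast1_atMost_eq binary_bit_eq_greedy[OF assms])
  then show ?thesis
    using greedy_rest_bound[of u D] assms
    by (simp add: power_divide divide_right_mono abs_le_iff)
qed

lemma binary_bit_sums: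
  assumes "u \<in> {-1..1}"
  shows "(\<lambda>d. binary_bit u (Suc d) / 2 ^ Suc d) sums u"
  using canonical_binary_bit[OF assms] by (simp add: canonical_expansion_def binary_expansion_def)

section \<open>Sigma-algebras generated by finitely many bits\<close>

lemma space_bit_algebra [simp]: "space (bit_algebra M A D) = space M"
  by (simp add: bit_algebra_def space_measure_of_conv)

lemma sets_bit_algebra:
  "sets (bit_algebra M A D) =
     sigma_sets (space M) (\<Union>d\<in>{1..D}. {A d -` S \<inter> space M | S. S \<in> sets borel})"
  unfolding bit_algebra_def by (rule sets_measure_of) auto

text \<open>Minimality of the generated sigma-algebra; with \<open>N\<close> taken as
  \<open>M\<close>, as the next stage and as the sigma-algebra of \<open>U\<close>, it gives all
  inclusions required below.\<close>

lemma sets_bit_algebra_subset: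
  assumes "space N = space M" "\<And>d. d \<in> {1..D} \<Longrightarrow> A d \<in> borel_measurable N"
  shows "sets (bit_algebra M A D) \<subseteq> sets N"
  unfolding sets_bit_algebra assms(1)[symmetric]
  by (rule sets.sigma_sets_subset) (use assms(2) in \<open>auto intro: measurable_sets\<close>)

lemma borel_measurable_bit_algebra:
  assumes "d \<in> {1..D}"
  shows "A d \<in> borel_measurable (bit_algebra M A D)"
proof (rule measurableI)
  fix S :: "real set" assume "S \<in> sets borel"
  then show "A d -` S \<inter> space (bit_algebra M A D) \<in> sets (bit_algebra M A D)"
    unfolding sets_bit_algebra space_bit_algebra
    by (intro sigma_sets.Basic UN_I[OF assms]) blast
qed simp

section \<open>The double limit for truncated binary expansions\<close>

theorem theorem4p6:
  fixes M :: "'a measure"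
    and U V :: "'a \<Rightarrow> real"
    and A B :: "nat \<Rightarrow> 'a \<Rightarrow> real"
  assumes "prob_space M"
    and "U \<in> borel_measurable M"
    and "V \<in> borel_measurable M"
    and "AE \<omega> in M. U \<omega> \<in> {-1..1}"
    and "AE \<omega> in M. V \<omega> \<in> {-1..1}"
    and "A = (\<lambda>d \<omega>. binary_bit (U \<omega>) d)"
    and "B = (\<lambda>d \<omega>. binary_bit (V \<omega>) d)"
  shows "AE \<omega> in M.
    ((\<lambda>(D1, D2). real_cond_exp M (bit_algebra M A D1) (\<lambda>\<omega>'. \<Sum>d=1..D2. B d \<omega>' / 2 ^ d) \<omega>)
      \<longlongrightarrow> real_cond_exp M (vimage_algebra (space M) U borel) V \<omega>)
    (sequentially \<times>\<^sub>F sequentially)"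
proof -
  interpret prob_space M by fact
  note [measurable] = \<open>U \<in> borel_measurable M\<close> \<open>V \<in> borel_measurable M\<close>
  let ?G = "vimage_algebra (space M) U borel"
  have U_G [measurable]: "U \<in> borel_measurable ?G"
    by (rule measurable_vimage_algebra1) simp
  have G: "subalgebra M ?G"
    by (simp add: subalgebra_def sets_image_in_sets)
  have A_M: "A d \<in> borel_measurable M" and A_G: "A d \<in> borel_measurable ?G" for d
    unfolding \<open>A = _\<close> by measurable
  have B_M [measurable]: "B d \<in> borel_measurable M" for d
    unfolding \<open>B = _\<close> by measurable
  \<comment> \<open>Bits are indexed from 1, so stage 0 of this filtration is the trivial
    sigma-algebra.\<close>
  interpret finite_filtration M "bit_algebra M A"
  proof
    show "subalgebra M (bit_algebra M A D)" for D
      using sets_bit_algebra_subset[of M M D A] A_M by (simp add: subalgebra_def)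
    show "sets (bit_algebra M A D) \<subseteq> sets (bit_algebra M A (Suc D))" for D
      by (intro sets_bit_algebra_subset borel_measurable_bit_algebra) auto
  qed
  have G_F_inf: "subalgebra ?G F_inf"
    using sets_bit_algebra_subset[of ?G M _ A] A_G
      sets.sigma_sets_subset[of "\<Union>D. sets (bit_algebra M A D)" ?G]
    by (simp add: subalgebra_def sets_F_inf UN_subset_iff)
  have "AE \<omega> in M. norm (V \<omega>) \<le> 1"
    using assms(5) by eventually_elim auto
  then have int_V: "integrable M V"
    by (rule integrable_const_bound) measurable

  \<comment> \<open>\<open>W\<close> rebuilds \<open>U\<close> from its bits: it is measurable in
    \<open>F_inf\<close> and can differ from \<open>U\<close> only where \<open>U\<close> leaves
    [-1, 1]. Replacing \<open>U\<close> by \<open>W\<close> in a preimage gives the counterpart in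
    \<open>F_inf\<close>.\<close>
  define W where "W \<omega> = (\<Sum>d. A (Suc d) \<omega> / 2 ^ Suc d)" for \<omega>
  have "A (Suc d) \<in> borel_measurable F_inf" for d
    by (rule measurable_from_subalg[OF subalgebra_F_inf_F[of "Suc d"]])
      (simp add: borel_measurable_bit_algebra)
  then have W [measurable]: "W \<in> borel_measurable F_inf"
    unfolding W_def by measurable
  have W_eq: "AE \<omega> in M. U \<omega> = W \<omega>"
    using assms(4)
  proof eventually_elim
    case (elim \<omega>)
    then show ?case
      using sums_unique[OF binary_bit_sums] by (simp add: W_def \<open>A = _\<close>)
  qed
  have eq_inf: "AE \<omega> in M. real_cond_exp M ?G V \<omega> = real_cond_exp M F_inf V \<omega>"
  proof (rule real_cond_exp_null_extension[OF finite_measure_axioms G G_F_inf _ int_V])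
    fix S assume "S \<in> sets ?G"
    then obtain S' where S': "S' \<in> sets borel" "S = U -` S' \<inter> space M"
      by (auto simp: sets_vimage_algebra2)
    have "W -` S' \<inter> space M \<in> sets F_inf"
      using measurable_sets[OF W S'(1)] by simp
    moreover have "AE \<omega> in M. \<omega> \<in> S \<longleftrightarrow> \<omega> \<in> W -` S' \<inter> space M"
      using W_eq by eventually_elim (simp add: S'(2))
    ultimately show "\<exists>T\<in>sets F_inf. AE \<omega> in M. \<omega> \<in> S \<longleftrightarrow> \<omega> \<in> T"
      by blast
  qed

  define S where "S D \<omega> = (\<Sum>d=1..D. B d \<omega> / 2 ^ d)" for D \<omega>
  have S_M [measurable]: "S D \<in> borel_measurable M" for D
    unfolding S_def by measurable
  have S_V: "AE \<omega> in M. \<bar>S D \<omega> - V \<omega>\<bar> \<le> (1 / 2) ^ D" for D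
    using assms(5)
  proof eventually_elim
    case (elim \<omega>)
    then show ?case
      using binary_bit_partial_sum_error[of "V \<omega>" D] by (simp add: S_def \<open>B = _\<close>)
  qed
  have int_diff: "integrable M (\<lambda>\<omega>. S D \<omega> - V \<omega>)" for D
    using S_V by (intro integrable_const_bound[where B = "(1 / 2) ^ D"]) auto
  have int_S: "integrable M (S D)" for D
    using Bochner_Integration.integrable_add[OF int_diff int_V] by simp
  have close: "AE \<omega> in M. \<bar>real_cond_exp M (bit_algebra M A D1) (S D2) \<omega>
      - real_cond_exp M (bit_algebra M A D1) V \<omega>\<bar> \<le> (1 / 2) ^ D2" for D1 D2
  proof -
    have "AE \<omega> in M. S D2 \<omega> - V \<omega> \<le> (1 / 2) ^ D2" "AE \<omega> in M. S D2 \<omega> - V \<omega> \<ge> - ((1 / 2) ^ D2)"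
      using S_V[of D2] by (eventually_elim, linarith)+
    note F.real_cond_exp_le_c[OF int_diff this(1), of D1]
      F.real_cond_exp_ge_c[OF int_diff this(2), of D1] F.real_cond_exp_diff[OF int_S int_V, of D1 D2]
    then show ?thesis
      by eventually_elim (simp add: abs_le_iff)
  qed
  \<comment> \<open>There are countably many pairs of depths, so one null set serves them all and
    the limit can be taken at a fixed point.\<close>
  have "AE \<omega> in M. \<forall>D1 D2. \<bar>real_cond_exp M (bit_algebra M A D1) (S D2) \<omega>
      - real_cond_exp M (bit_algebra M A D1) V \<omega>\<bar> \<le> (1 / 2) ^ D2"
    unfolding AE_all_countable using close by blast
  with levy_upward[OF int_V] eq_inf show ?thesis
  proof eventually_elim
    case (elim \<omega>)
    let ?E = "\<lambda>D f. real_cond_exp M (bit_algebra M A D) f \<omega>"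
    \<comment> \<open>The main term depends on \<open>D1\<close> alone and the error bound on
      \<open>D2\<close> alone, so each limit is taken along one coordinate and no relation between
      the rates is used.\<close>
    have "((\<lambda>D. ?E (fst D) V) \<longlongrightarrow> real_cond_exp M ?G V \<omega>) (sequentially \<times>\<^sub>F sequentially)"
      unfolding elim(2) by (rule filterlim_compose[OF elim(1) filterlim_fst])
    moreover have "((\<lambda>D. ?E (fst D) (S (snd D)) - ?E (fst D) V) \<longlongrightarrow> 0)
        (sequentially \<times>\<^sub>F sequentially)"
    proof (rule Lim_null_comparison)
      have "(\<lambda>n. (1 / 2 :: real) ^ n) \<longlonglongrightarrow> 0"
        by (rule LIMSEQ_realpow_zero) auto
      then show "((\<lambda>D. (1 / 2 :: real) ^ snd D) \<longlongrightarrow> 0) (sequentially \<times>\<^sub>F sequentially)"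
        by (rule filterlim_compose[OF _ filterlim_snd])
    qed (use elim(3) in auto)
    ultimately have "((\<lambda>D. (?E (fst D) (S (snd D)) - ?E (fst D) V) + ?E (fst D) V)
        \<longlongrightarrow> 0 + real_cond_exp M ?G V \<omega>) (sequentially \<times>\<^sub>F sequentially)"
      by (intro tendsto_add)
    then show ?case
      by (simp add: S_def[abs_def] case_prod_unfold)
  qed
qed

end
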